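(* Let $\Psi:(0,\infty)\to[0,\infty)$ be a non-increasing function. Then $[X,d,m,\nu]$ satisfies a $\Psi$-isoperimetric inequality, i.e. $$\nu(A)\,\Psi(\nu(A))\le P_m(A)\quad\text{for all } \nu\text{-measurable } A\subset X\text{ with } 0<\nu(A)<\nu(X),$$ if, and only if, $$\Psi(\nu(A))\,\|u\|_{L^1(X,\nu)}\le TV_m(u)$$ for all $\nu$-measurable sets $A\subset X$ with $0<\nu(A)<\nu(X)$ and all $u\in L^1(X,\nu)$ with $u=0$ in $X\setminus A$.
   Context: Metric random walk space: $(X,d)$ is a Polish metric space with its Borel $\sigma$-algebra and $m=(m_x)_{x\in X}$ is a family of Borel probability measures on $X$ such that $x\mapsto m_x(A)$ is Borel for every Borel set $A$, and each $m_x$ has finite first moment ($\int_X d(z,y)\,dm_x(y)<\infty$ for some, hence every, $z\in X$). $\nu$ is a $\sigma$-finite Radon measure on $X$ that is invariant, $\nu(A)=\int_X m_x(A)\,d\nu(x)$, and reversible for $m$: for every Borel $C\subset X\times X$, $\int_X\int_X\chi_C(x,y)\,dm_x(y)d\nu(x)=\int_X\int_X\chi_C(x,y)\,dm_y(x)d\nu(y)$. Put $L_m(A,B)=\int_A\int_B dm_x(y)d\nu(x)$; the space is assumed $m$-connected: $L_m(A,B)>0$ for any $\nu$-measurable sets $A,B$ of positive $\nu$-measure with $A\cup B=X$. $P_m(E)=L_m(E,X\setminus E)=\int_E\int_{X\setminus E}dm_x(y)d\nu(x)$ and, for $\nu$-measurable $u:X\to\mathbb R$, $TV_m(u)=\frac12\int_X\int_X|u(y)-u(x)|\,dm_x(y)d\nu(x)$.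 *)

theory Defs
  imports "HOL-Probability.Probability"
begin

text \<open>
  The metric space is the type \<^typ>\<open>'a\<close>, of class \<^class>\<open>polish_space\<close> (complete, second
  countable). A set is \<open>\<nu>\<close>-measurable if it belongs to the completion of the Borel measure
  \<open>\<nu>\<close>. If \<open>\<nu>\<close> is invariant for \<open>m\<close>, such a set is also measurable for the completion of
  \<open>m x\<close>, for \<open>\<nu>\<close>-almost every \<open>x\<close>; this is why the iterated integrals below are taken with
  respect to completions. They agree with the ordinary ones on Borel sets and functions.
\<close>

definition radon_measure :: "'a::topological_space measure \<Rightarrow> bool" where
  "radon_measure \<nu> \<longleftrightarrow>
     sets \<nu> = sets borel \<and>
     (\<forall>x. \<exists>U. open U \<and> x \<in> U \<and> emeasure \<nu> U < \<infinity>) \<and>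
     (\<forall>A\<in>sets borel. emeasure \<nu> A = (SUP K\<in>{K. compact K \<and> K \<subseteq> A}. emeasure \<nu> K))"

locale metric_random_walk_space =
  fixes m :: "'a::polish_space \<Rightarrow> 'a measure"
  assumes sets_m: "sets (m x) = sets borel"
    and prob_space_m: "prob_space (m x)"
    and measurable_m: "A \<in> sets borel \<Longrightarrow> (\<lambda>x. emeasure (m x) A) \<in> borel_measurable borel"
    and finite_first_moment: "\<exists>z. (\<integral>\<^sup>+ y. ennreal (dist z y) \<partial>m x) < \<infinity>"

definition L_m :: "('a \<Rightarrow> 'a measure) \<Rightarrow> 'a measure \<Rightarrow> 'a set \<Rightarrow> 'a set \<Rightarrow> ennreal" where
  "L_m m \<nu> A B = (\<integral>\<^sup>+ x \<in> A. (\<integral>\<^sup>+ y \<in> B. 1 \<partial>completion (m x)) \<partial>completion \<nu>)"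

definition P_m :: "('a \<Rightarrow> 'a measure) \<Rightarrow> 'a measure \<Rightarrow> 'a set \<Rightarrow> ennreal" where
  "P_m m \<nu> E = L_m m \<nu> E (UNIV - E)"

definition TV_m :: "('a \<Rightarrow> 'a measure) \<Rightarrow> 'a measure \<Rightarrow> ('a \<Rightarrow> real) \<Rightarrow> ennreal" where
  "TV_m m \<nu> u =
     1 / 2 * (\<integral>\<^sup>+ x. (\<integral>\<^sup>+ y. ennreal \<bar>u y - u x\<bar> \<partial>completion (m x)) \<partial>completion \<nu>)"

locale connected_reversible_random_walk_space =
  metric_random_walk_space m + sigma_finite_measure \<nu>
  for m :: "'a::polish_space \<Rightarrow> 'a measure" and \<nu> :: "'a measure" +
  assumes radon: "radon_measure \<nu>"
    and invariant: "A \<in> sets borel \<Longrightarrow> emeasure \<nu> A = (\<integral>\<^sup>+ x. emeasure (m x) A \<partial>\<nu>)"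
    and reversible: "C \<in> sets (borel :: ('a \<times> 'a) measure) \<Longrightarrow>
      (\<integral>\<^sup>+ x. (\<integral>\<^sup>+ y. indicator C (x, y) \<partial>m x) \<partial>\<nu>) =
      (\<integral>\<^sup>+ y. (\<integral>\<^sup>+ x. indicator C (x, y) \<partial>m y) \<partial>\<nu>)"
    and m_connected: "\<lbrakk>A \<in> sets (completion \<nu>); B \<in> sets (completion \<nu>);
      emeasure (completion \<nu>) A > 0; emeasure (completion \<nu>) B > 0; A \<union> B = UNIV\<rbrakk> \<Longrightarrow>
      L_m m \<nu> A B > 0"

text \<open>
  The condition \<open>0 < \<nu>(A) < \<nu>(X)\<close> makes \<open>\<nu>(A)\<close> finite, so that the real number
  \<^term>\<open>measure (completion \<nu>) A\<close> is its value and lies in the domain \<open>(0, \<infinity>)\<close> of \<open>\<Psi>\<close>.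
\<close>

definition isoperimetric_inequality ::
  "(real \<Rightarrow> real) \<Rightarrow> ('a \<Rightarrow> 'a measure) \<Rightarrow> 'a measure \<Rightarrow> bool" where
  "isoperimetric_inequality \<Psi> m \<nu> \<longleftrightarrow>
     (\<forall>A\<in>sets (completion \<nu>).
        0 < emeasure (completion \<nu>) A \<and> emeasure (completion \<nu>) A < emeasure (completion \<nu>) UNIV \<longrightarrow>
        emeasure (completion \<nu>) A * ennreal (\<Psi> (measure (completion \<nu>) A)) \<le> P_m m \<nu> A)"

end

theory Submission
  imports Defs
begin

text \<open>
  Both directions rest on the coarea formula: \<open>TV_m(u)\<close> is the integral of \<open>P_m({u > t})\<close> over
  all real \<open>t\<close>. It holds because \<open>\<bar>u y - u x\<bar>\<close> is the length of the interval of levels \<open>t\<close> that separate \<open>u x\<close>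
  from \<open>u y\<close>. Exchanging the integrals, each level contributes the flow out of \<open>{u > t}\<close> plus the
  flow into it. Reversibility makes these two equal, which cancels the factor \<open>1 / 2\<close>
  (\<open>TV_m_coarea\<close>).

  For \<open>u\<close> the indicator function of \<open>A\<close>, the set \<open>{u > t}\<close> is \<open>A\<close> for \<open>0 \<le> t < 1\<close> and has no
  perimeter for any other \<open>t\<close>, so \<open>TV_m(u) = P_m(A)\<close> and the functional inequality contains the
  isoperimetric one.

  Conversely, let \<open>u\<close> vanish outside \<open>A\<close>. The triangle inequality gives
  \<open>TV_m(\<bar>u\<bar>) \<le> TV_m(u)\<close>. For \<open>t \<ge> 0\<close> the set \<open>E = {\<bar>u\<bar> > t}\<close> lies in \<open>A\<close> up to a null set, so
  \<open>\<nu>(E) \<le> \<nu>(A)\<close> and, \<open>\<Psi>\<close> being non-increasing,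
  \<open>\<Psi>(\<nu>(A)) \<nu>(E) \<le> \<Psi>(\<nu>(E)) \<nu>(E) \<le> P_m(E)\<close>. Integrating over \<open>t\<close> turns the left side into
  \<open>\<Psi>(\<nu>(A))\<close> times the \<open>L\<^sup>1\<close> norm of \<open>u\<close> (\<open>nn_integral_abs_layer_cake\<close>) and the right side
  into at most \<open>TV_m(\<bar>u\<bar>)\<close>.

  Functions that are measurable only for the completion of \<open>\<nu>\<close> reduce to Borel functions:
  invariance implies that a \<open>\<nu>\<close>-null set is \<open>m x\<close>-null for \<open>\<nu>\<close>-almost every \<open>x\<close>, so that neither
  \<open>TV_m\<close> nor \<open>P_m\<close> notices a change on a null set.
\<close>

section \<open>Real functions and their level sets\<close>

lemma ennreal_abs_diff_eq_levels:
  fixes a b :: real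
  shows "ennreal \<bar>a - b\<bar> =
    (\<integral>\<^sup>+ t. indicator {t. b \<le> t \<and> t < a} t + indicator {t. a \<le> t \<and> t < b} t \<partial>lborel)"
proof -
  have "{t. b \<le> t \<and> t < a} = {b..<a}" "{t. a \<le> t \<and> t < b} = {a..<b}"
    by auto
  then show ?thesis
    by (cases "a \<le> b") (simp_all add: nn_integral_add)
qed

lemma (in sigma_finite_measure) nn_integral_abs_layer_cake:
  fixes u :: "'a \<Rightarrow> real"
  assumes "u \<in> borel_measurable (completion M)"
  shows "(\<integral>\<^sup>+ x. ennreal \<bar>u x\<bar> \<partial>completion M) =
    (\<integral>\<^sup>+ t. indicator {0..} t * emeasure (completion M) {x \<in> space M. t < \<bar>u x\<bar>} \<partial>lborel)"
proof -
  obtain v where v [measurable]: "v \<in> borel_measurable M" and uv: "AE x in M. u x = v x"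
    using completion_ex_borel_measurable_real[OF assms] by blast
  interpret P: pair_sigma_finite M lborel
    by unfold_locales
  have "(\<integral>\<^sup>+ x. ennreal \<bar>u x\<bar> \<partial>completion M) = (\<integral>\<^sup>+ x. ennreal \<bar>v x\<bar> \<partial>M)"
    unfolding nn_integral_completion by (rule nn_integral_cong_AE) (use uv in auto)
  also have "\<dots> = (\<integral>\<^sup>+ x. (\<integral>\<^sup>+ t. indicator {t. 0 \<le> t \<and> t < \<bar>v x\<bar>} t \<partial>lborel) \<partial>M)"
  proof (rule nn_integral_cong)
    fix x
    have "{t. 0 \<le> t \<and> t < \<bar>v x\<bar>} = {0..<\<bar>v x\<bar>}"
      by auto
    then show "ennreal \<bar>v x\<bar> = (\<integral>\<^sup>+ t. indicator {t. 0 \<le> t \<and> t < \<bar>v x\<bar>} t \<partial>lborel)"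
      by simp
  qed
  also have "\<dots> = (\<integral>\<^sup>+ t. (\<integral>\<^sup>+ x. indicator {t. 0 \<le> t \<and> t < \<bar>v x\<bar>} t \<partial>M) \<partial>lborel)"
    by (rule P.Fubini'[symmetric]) (unfold split_beta' indicator_def mem_Collect_eq, measurable)
  also have "\<dots> =
    (\<integral>\<^sup>+ t. indicator {0..} t * emeasure (completion M) {x \<in> space M. t < \<bar>u x\<bar>} \<partial>lborel)"
  proof (rule nn_integral_cong)
    fix t :: real
    have "(\<integral>\<^sup>+ x. indicator {t. 0 \<le> t \<and> t < \<bar>v x\<bar>} t \<partial>M) =
      (\<integral>\<^sup>+ x. indicator {0..} t * indicator {x \<in> space M. t < \<bar>v x\<bar>} x \<partial>M)"
      by (rule nn_integral_cong) (auto simp: indicator_def)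
    also have "\<dots> = indicator {0..} t * emeasure (completion M) {x \<in> space M. t < \<bar>v x\<bar>}"
      by (simp add: nn_integral_cmult)
    also have "emeasure (completion M) {x \<in> space M. t < \<bar>v x\<bar>} =
      emeasure (completion M) {x \<in> space M. t < \<bar>u x\<bar>}"
    proof (rule emeasure_eq_AE)
      show "AE x in completion M.
        (x \<in> {x \<in> space M. t < \<bar>v x\<bar>}) = (x \<in> {x \<in> space M. t < \<bar>u x\<bar>})"
        unfolding AE_completion_iff using uv by auto
      show "{x \<in> space M. t < \<bar>u x\<bar>} \<in> sets (completion M)"
      proof -
        have "{x \<in> space (completion M). t < \<bar>u x\<bar>} \<in> sets (completion M)"
          using assms by measurable
        then show ?thesis by simp
      qed
      have "{x \<in> space M. t < \<bar>v x\<bar>} \<in> sets M" by measurable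
      then show "{x \<in> space M. t < \<bar>v x\<bar>} \<in> sets (completion M)"
        by (rule sets_completionI_sets)
    qed
    finally show "(\<integral>\<^sup>+ x. indicator {t. 0 \<le> t \<and> t < \<bar>v x\<bar>} t \<partial>M) =
      indicator {0..} t * emeasure (completion M) {x \<in> space M. t < \<bar>u x\<bar>}" .
  qed
  finally show ?thesis .
qed

section \<open>Perimeter and total variation\<close>

lemma P_m_eq_nn_integral:
  "P_m m \<nu> E = (\<integral>\<^sup>+ x. (\<integral>\<^sup>+ y. indicator {(x, y). x \<in> E \<and> y \<notin> E} (x, y) \<partial>m x) \<partial>\<nu>)"
  unfolding P_m_def L_m_def nn_integral_completion
  by (auto intro!: nn_integral_cong simp: indicator_def)

lemma P_m_trivial [simp]: "P_m m \<nu> {} = 0" "P_m m \<nu> UNIV = 0"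
  by (simp_all add: P_m_eq_nn_integral)

lemma TV_m_abs_le: "TV_m m \<nu> (\<lambda>x. \<bar>u x\<bar>) \<le> TV_m m \<nu> u"
  unfolding TV_m_def by (intro mult_left_mono nn_integral_mono ennreal_leI) auto

section \<open>Null sets and iterated integrals along the random walk\<close>

context connected_reversible_random_walk_space
begin

lemma sets_nu [measurable_cong]: "sets \<nu> = sets borel"
  using radon by (simp add: radon_measure_def)

lemma space_nu [simp]: "space \<nu> = UNIV"
  using sets_eq_imp_space_eq[OF sets_nu] by simp

lemma m_measurable [measurable]: "m \<in> borel \<rightarrow>\<^sub>M subprob_algebra borel"
  by (rule measurable_subprob_algebra)
    (auto simp: sets_m prob_space_m prob_space_imp_subprob_space intro: measurable_m)

text \<open>
  By invariance, the mean of \<open>m x N\<close> over \<open>x\<close> is \<open>\<nu> N\<close>; if this vanishes, then so does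
  \<open>m x N\<close> for almost every \<open>x\<close>.
\<close>

lemma AE_nu_imp_AE_m:
  assumes "AE x in \<nu>. P x"
  shows "AE x in \<nu>. AE y in m x. P y"
proof -
  obtain N where N: "{x \<in> space \<nu>. \<not> P x} \<subseteq> N" "emeasure \<nu> N = 0" "N \<in> sets \<nu>"
    using AE_E[OF assms] by blast
  then have [measurable]: "N \<in> sets borel"
    by (simp add: sets_nu)
  have "(\<integral>\<^sup>+ x. emeasure (m x) N \<partial>\<nu>) = 0"
    using invariant N by (simp add: sets_nu)
  then have "AE x in \<nu>. emeasure (m x) N = 0"
    by (subst (asm) nn_integral_0_iff_AE) auto
  then show ?thesis
  proof eventually_elim
    case (elim x)
    then have "N \<in> null_sets (m x)"
      by (simp add: null_sets_def sets_m)
    then show ?case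
      by (rule AE_I') (use N in auto)
  qed
qed

text \<open>
  The criterion by which \<open>TV_m\<close> and \<open>P_m\<close> are insensitive to null sets: an integrand built from
  the values at \<open>x\<close> and at \<open>y\<close> may be replaced by one that agrees with it whenever \<open>x\<close> and \<open>y\<close>
  both avoid a null set.
\<close>

lemma nn_integral_random_walk_cong:
  assumes "AE x in \<nu>. P x" and "\<And>x y. P x \<Longrightarrow> P y \<Longrightarrow> f x y = g x y"
  shows "(\<integral>\<^sup>+ x. (\<integral>\<^sup>+ y. f x y \<partial>m x) \<partial>\<nu>) = (\<integral>\<^sup>+ x. (\<integral>\<^sup>+ y. g x y \<partial>m x) \<partial>\<nu>)"
proof (rule nn_integral_cong_AE)
  show "AE x in \<nu>. (\<integral>\<^sup>+ y. f x y \<partial>m x) = (\<integral>\<^sup>+ y. g x y \<partial>m x)"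
    using assms(1) AE_nu_imp_AE_m[OF assms(1)]
  proof eventually_elim
    case (elim x)
    then show ?case
      using assms(2) by (intro nn_integral_cong_AE) auto
  qed
qed

lemma nn_integral_random_walk_Tonelli:
  assumes [measurable]: "f \<in> borel_measurable (borel \<Otimes>\<^sub>M borel \<Otimes>\<^sub>M lborel)"
  shows "(\<integral>\<^sup>+ x. (\<integral>\<^sup>+ y. (\<integral>\<^sup>+ t. f (x, y, t) \<partial>lborel) \<partial>m x) \<partial>\<nu>) =
    (\<integral>\<^sup>+ t. (\<integral>\<^sup>+ x. (\<integral>\<^sup>+ y. f (x, y, t) \<partial>m x) \<partial>\<nu>) \<partial>lborel)"
proof -
  have "(\<integral>\<^sup>+ y. (\<integral>\<^sup>+ t. f (x, y, t) \<partial>lborel) \<partial>m x) = (\<integral>\<^sup>+ t. (\<integral>\<^sup>+ y. f (x, y, t) \<partial>m x) \<partial>lborel)" for x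
  proof -
    interpret prob_space "m x" by (rule prob_space_m)
    interpret pair_sigma_finite "m x" lborel by unfold_locales
    have [measurable_cong]: "sets (m x) = sets borel" by (rule sets_m)
    show ?thesis
      by (rule Fubini'[symmetric]) measurable
  qed
  then have "(\<integral>\<^sup>+ x. (\<integral>\<^sup>+ y. (\<integral>\<^sup>+ t. f (x, y, t) \<partial>lborel) \<partial>m x) \<partial>\<nu>) =
    (\<integral>\<^sup>+ x. (\<integral>\<^sup>+ t. (\<integral>\<^sup>+ y. f (x, y, t) \<partial>m x) \<partial>lborel) \<partial>\<nu>)"
    by simp
  also have "\<dots> = (\<integral>\<^sup>+ t. (\<integral>\<^sup>+ x. (\<integral>\<^sup>+ y. f (x, y, t) \<partial>m x) \<partial>\<nu>) \<partial>lborel)"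
  proof -
    interpret pair_sigma_finite \<nu> lborel by unfold_locales
    have "(\<lambda>p. \<integral>\<^sup>+ y. f (fst p, y, snd p) \<partial>m (fst p)) \<in> borel_measurable (\<nu> \<Otimes>\<^sub>M lborel)"
      by (rule nn_integral_measurable_subprob_algebra2[where N = borel]) measurable
    then show ?thesis
      by (intro Fubini'[symmetric]) (simp add: split_beta')
  qed
  finally show ?thesis .
qed

lemma nn_integral_reversible:
  assumes "C \<in> sets (borel \<Otimes>\<^sub>M borel)"
  shows "(\<integral>\<^sup>+ x. (\<integral>\<^sup>+ y. indicator C (y, x) \<partial>m x) \<partial>\<nu>) =
    (\<integral>\<^sup>+ x. (\<integral>\<^sup>+ y. indicator C (x, y) \<partial>m x) \<partial>\<nu>)"
  using assms unfolding borel_prod by (rule reversible[symmetric])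

section \<open>The coarea formula\<close>

text \<open>
  A level \<open>t\<close> separates \<open>u x\<close> from \<open>u y\<close> if \<open>(x, y)\<close> or \<open>(y, x)\<close> lies in the set \<open>C t\<close> of
  the jumps that leave \<open>{u > t}\<close>. By Tonelli, the double integral of \<open>\<bar>u y - u x\<bar>\<close> is therefore
  the integral over \<open>t\<close> of the flows through \<open>C t\<close> and through its transpose; both equal
  \<open>P_m({u > t})\<close>, the second one by reversibility.
\<close>

lemma TV_m_coarea_borel:
  fixes u :: "'a \<Rightarrow> real"
  assumes [measurable]: "u \<in> borel_measurable borel"
  shows "TV_m m \<nu> u = (\<integral>\<^sup>+ t. P_m m \<nu> {x. t < u x} \<partial>lborel)"
proof -
  define C where "C t = {(x, y). t < u x \<and> u y \<le> t}" for t
  have C [measurable]: "C t \<in> sets (borel \<Otimes>\<^sub>M borel)" for t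
  proof -
    have "C t = {p \<in> space (borel \<Otimes>\<^sub>M borel). t < u (fst p) \<and> u (snd p) \<le> t}"
      by (auto simp: C_def space_pair_measure)
    also have "\<dots> \<in> sets (borel \<Otimes>\<^sub>M borel)" by measurable
    finally show ?thesis .
  qed
  have P: "(\<integral>\<^sup>+ x. (\<integral>\<^sup>+ y. indicator (C t) (x, y) \<partial>m x) \<partial>\<nu>) = P_m m \<nu> {x. t < u x}" for t
    by (simp add: P_m_eq_nn_integral C_def not_less)
  have "(\<integral>\<^sup>+ x. (\<integral>\<^sup>+ y. ennreal \<bar>u y - u x\<bar> \<partial>m x) \<partial>\<nu>) =
    (\<integral>\<^sup>+ x. (\<integral>\<^sup>+ y. (\<integral>\<^sup>+ t. indicator (C t) (y, x) + indicator (C t) (x, y) \<partial>lborel) \<partial>m x) \<partial>\<nu>)"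
    by (intro nn_integral_cong, subst ennreal_abs_diff_eq_levels, intro nn_integral_cong)
      (auto simp: C_def indicator_def)
  also have "\<dots> =
    (\<integral>\<^sup>+ t. (\<integral>\<^sup>+ x. (\<integral>\<^sup>+ y. indicator (C t) (y, x) + indicator (C t) (x, y) \<partial>m x) \<partial>\<nu>) \<partial>lborel)"
  proof -
    have "(\<lambda>(x, y, t). indicator (C t) (y, x) + indicator (C t) (x, y) :: ennreal)
      \<in> borel_measurable (borel \<Otimes>\<^sub>M borel \<Otimes>\<^sub>M lborel)"
      unfolding C_def indicator_def mem_Collect_eq split_beta' fst_conv snd_conv by measurable
    from nn_integral_random_walk_Tonelli[OF this] show ?thesis by simp
  qed
  also have "\<dots> = (\<integral>\<^sup>+ t. 2 * P_m m \<nu> {x. t < u x} \<partial>lborel)"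
  proof (rule nn_integral_cong)
    fix t :: real
    have [measurable]:
      "(\<lambda>x. \<integral>\<^sup>+ y. indicator (C t) (y, x) \<partial>m x) \<in> borel_measurable \<nu>"
      "(\<lambda>x. \<integral>\<^sup>+ y. indicator (C t) (x, y) \<partial>m x) \<in> borel_measurable \<nu>"
      by (rule nn_integral_measurable_subprob_algebra2[where N = borel]; measurable)+
    have "(\<integral>\<^sup>+ y. indicator (C t) (y, x) + indicator (C t) (x, y) \<partial>m x) =
      (\<integral>\<^sup>+ y. indicator (C t) (y, x) \<partial>m x) + (\<integral>\<^sup>+ y. indicator (C t) (x, y) \<partial>m x)" for x
    proof -
      have [measurable_cong]: "sets (m x) = sets borel" by (rule sets_m)
      show ?thesis by (rule nn_integral_add) measurable
    qed
    then have "(\<integral>\<^sup>+ x. (\<integral>\<^sup>+ y. indicator (C t) (y, x) + indicator (C t) (x, y) \<partial>m x) \<partial>\<nu>) =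
      (\<integral>\<^sup>+ x. (\<integral>\<^sup>+ y. indicator (C t) (y, x) \<partial>m x) \<partial>\<nu>) +
      (\<integral>\<^sup>+ x. (\<integral>\<^sup>+ y. indicator (C t) (x, y) \<partial>m x) \<partial>\<nu>)"
      by (simp add: nn_integral_add)
    then show "(\<integral>\<^sup>+ x. (\<integral>\<^sup>+ y. indicator (C t) (y, x) + indicator (C t) (x, y) \<partial>m x) \<partial>\<nu>) =
      2 * P_m m \<nu> {x. t < u x}"
      by (simp add: nn_integral_reversible P mult_2)
  qed
  also have "\<dots> = 2 * (\<integral>\<^sup>+ t. P_m m \<nu> {x. t < u x} \<partial>lborel)"
  proof (rule nn_integral_cmult)
    \<comment> \<open>Measurability of the perimeter in \<open>t\<close> comes from joint measurability in \<open>(x, t)\<close>.\<close>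
    have "(\<lambda>(x, t). \<integral>\<^sup>+ y. indicator (C t) (x, y) \<partial>m x) \<in> borel_measurable (\<nu> \<Otimes>\<^sub>M lborel)"
      unfolding split_beta'
      by (rule nn_integral_measurable_subprob_algebra2[where N = borel])
        (unfold C_def indicator_def mem_Collect_eq split_beta' fst_conv snd_conv, measurable)
    then have "(\<lambda>(t, x). \<integral>\<^sup>+ y. indicator (C t) (x, y) \<partial>m x) \<in> borel_measurable (lborel \<Otimes>\<^sub>M \<nu>)"
      by (subst measurable_pair_swap_iff) (simp add: split_beta')
    then show "(\<lambda>t. P_m m \<nu> {x. t < u x}) \<in> borel_measurable lborel"
      unfolding P[symmetric] by (rule borel_measurable_nn_integral)
  qed
  finally show ?thesis
    unfolding TV_m_def nn_integral_completion
    by (simp add: mult.assoc[symmetric] ennreal_divide_times)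
qed

theorem TV_m_coarea:
  fixes u :: "'a \<Rightarrow> real"
  assumes "u \<in> borel_measurable (completion \<nu>)"
  shows "TV_m m \<nu> u = (\<integral>\<^sup>+ t. P_m m \<nu> {x. t < u x} \<partial>lborel)"
proof -
  obtain v where v: "v \<in> borel_measurable \<nu>" and uv: "AE x in \<nu>. u x = v x"
    using completion_ex_borel_measurable_real[OF assms] by blast
  have "v \<in> borel_measurable borel"
    using v by (simp cong: measurable_cong_sets add: sets_nu)
  moreover have "TV_m m \<nu> u = TV_m m \<nu> v"
    unfolding TV_m_def nn_integral_completion
    by (subst nn_integral_random_walk_cong[OF uv]) auto
  moreover have "P_m m \<nu> {x. t < u x} = P_m m \<nu> {x. t < v x}" for t
    unfolding P_m_eq_nn_integral
    by (rule nn_integral_random_walk_cong[OF uv]) (auto simp: indicator_def)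
  ultimately show ?thesis
    by (simp add: TV_m_coarea_borel)
qed

section \<open>Isoperimetric and functional inequality\<close>

lemma TV_m_indicator:
  assumes "A \<in> sets (completion \<nu>)"
  shows "TV_m m \<nu> (indicator A) = P_m m \<nu> A"
proof -
  have "{x. t < indicator A x} = (if t < 0 then UNIV else if t < 1 then A else {})" for t :: real
    by (auto simp: indicator_def)
  then have "P_m m \<nu> {x. t < indicator A x} = P_m m \<nu> A * indicator {0..<1} t" for t :: real
    by (auto simp: indicator_def)
  then show ?thesis
    using assms by (simp add: TV_m_coarea nn_integral_cmult_indicator)
qed

text \<open>
  The isoperimetric inequality is applied to every level set \<open>{\<bar>u\<bar> > t}\<close> with \<open>t \<ge> 0\<close>, with
  \<open>\<Psi>\<close> at the measure of the level set lowered to \<open>\<Psi>\<close> at the measure of \<open>A\<close>; integrating over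
  \<open>t\<close> recovers the \<open>L\<^sup>1\<close> norm on one side and, by the coarea formula, the total variation on
  the other.
\<close>

lemma TV_m_ge_if_isoperimetric:
  fixes u :: "'a \<Rightarrow> real"
  assumes iso: "isoperimetric_inequality \<Psi> m \<nu>"
    and \<Psi>: "antimono_on {0<..} \<Psi>"
    and A: "A \<in> sets (completion \<nu>)" "emeasure (completion \<nu>) A < emeasure (completion \<nu>) UNIV"
    and u [measurable]: "u \<in> borel_measurable (completion \<nu>)"
    and zero: "AE x in completion \<nu>. x \<notin> A \<longrightarrow> u x = 0"
  shows "ennreal (\<Psi> (measure (completion \<nu>) A)) * (\<integral>\<^sup>+ x. ennreal \<bar>u x\<bar> \<partial>completion \<nu>) \<le> TV_m m \<nu> u"
proof -
  let ?\<mu> = "completion \<nu>"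
  let ?E = "\<lambda>t. {x. t < \<bar>u x\<bar>}"
  have E [measurable]: "?E t \<in> sets ?\<mu>" for t
  proof -
    have "{x \<in> space ?\<mu>. t < \<bar>u x\<bar>} \<in> sets ?\<mu>" by measurable
    then show ?thesis by simp
  qed
  have level: "ennreal (\<Psi> (measure ?\<mu> A)) * emeasure ?\<mu> (?E t) \<le> P_m m \<nu> (?E t)" if "0 \<le> t" for t
    \<comment> \<open>At \<open>0\<close> nothing is known about \<open>\<Psi>\<close>, so null level sets are treated apart.\<close>
  proof (cases "emeasure ?\<mu> (?E t) = 0")
    case False
    have le: "emeasure ?\<mu> (?E t) \<le> emeasure ?\<mu> A"
      by (rule emeasure_mono_AE) (use zero that A in auto)
    have fin: "emeasure ?\<mu> A < \<infinity>"
      using A(2) by (rule less_le_trans) simp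
    have "measure ?\<mu> (?E t) \<le> measure ?\<mu> A"
      unfolding measure_def using le fin by (intro enn2real_mono) auto
    moreover have "0 < measure ?\<mu> (?E t)"
      unfolding measure_def using False le fin
      by (simp add: enn2real_positive_iff zero_less_iff_neq_zero)
    ultimately have "\<Psi> (measure ?\<mu> A) \<le> \<Psi> (measure ?\<mu> (?E t))"
      using \<Psi> by (auto simp: monotone_on_def)
    then have "ennreal (\<Psi> (measure ?\<mu> A)) * emeasure ?\<mu> (?E t) \<le>
      emeasure ?\<mu> (?E t) * ennreal (\<Psi> (measure ?\<mu> (?E t)))"
      by (subst mult.commute) (intro mult_left_mono ennreal_leI, auto)
    also have "\<dots> \<le> P_m m \<nu> (?E t)"
      using iso E[of t] False le A(2)
      by (auto simp: isoperimetric_inequality_def zero_less_iff_neq_zero)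
    finally show ?thesis .
  qed simp
  have "(\<lambda>t. indicator {0..} t * emeasure ?\<mu> (?E t)) \<in> borel_measurable lborel"
  proof -
    have "antimono (\<lambda>t. emeasure ?\<mu> (?E t))"
      by (intro antimonoI emeasure_mono) auto
    \<comment> \<open>The superlevel sets of a non-increasing function are down-closed, hence intervals.\<close>
    then have "is_interval {t. y < emeasure ?\<mu> (?E t)}" for y
      unfolding is_interval_1 by (auto dest: antimonoD intro: less_le_trans)
    then have "(\<lambda>t. emeasure ?\<mu> (?E t)) \<in> borel_measurable borel"
      by (intro borel_measurableI_greater) (simp add: real_interval_borel_measurable)
    then show ?thesis by measurable
  qed
  then have "ennreal (\<Psi> (measure ?\<mu> A)) * (\<integral>\<^sup>+ x. ennreal \<bar>u x\<bar> \<partial>?\<mu>) =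
    (\<integral>\<^sup>+ t. ennreal (\<Psi> (measure ?\<mu> A)) * (indicator {0..} t * emeasure ?\<mu> (?E t)) \<partial>lborel)"
    by (simp add: nn_integral_abs_layer_cake nn_integral_cmult)
  also have "\<dots> \<le> (\<integral>\<^sup>+ t. P_m m \<nu> (?E t) \<partial>lborel)"
    by (rule nn_integral_mono) (auto simp: indicator_def level simp del: emeasure_completion)
  also have "\<dots> = TV_m m \<nu> (\<lambda>x. \<bar>u x\<bar>)"
    by (rule TV_m_coarea[symmetric]) measurable
  also have "\<dots> \<le> TV_m m \<nu> u"
    by (rule TV_m_abs_le)
  finally show ?thesis .
qed

end

theorem proposition2p14:
  fixes m :: "'a::polish_space \<Rightarrow> 'a measure" and \<nu> :: "'a measure" and \<Psi> :: "real \<Rightarrow> real"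
  assumes "connected_reversible_random_walk_space m \<nu>"
    and "\<And>t. t > 0 \<Longrightarrow> \<Psi> t \<ge> 0"
    and "antimono_on {0<..} \<Psi>"
  shows "isoperimetric_inequality \<Psi> m \<nu> \<longleftrightarrow>
    (\<forall>A\<in>sets (completion \<nu>).
       0 < emeasure (completion \<nu>) A \<and> emeasure (completion \<nu>) A < emeasure (completion \<nu>) UNIV \<longrightarrow>
       (\<forall>u. integrable (completion \<nu>) u \<and> (AE x in completion \<nu>. x \<notin> A \<longrightarrow> u x = 0) \<longrightarrow>
          ennreal (\<Psi> (measure (completion \<nu>) A)) *
            ennreal (\<integral>x. \<bar>u x\<bar> \<partial>completion \<nu>) \<le> TV_m m \<nu> u))"
    (is "_ \<longleftrightarrow> ?functional")
proof
  interpret connected_reversible_random_walk_space m \<nu> by fact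
  let ?\<mu> = "completion \<nu>"
  have L1: "ennreal (\<integral>x. \<bar>u x\<bar> \<partial>?\<mu>) = (\<integral>\<^sup>+ x. ennreal \<bar>u x\<bar> \<partial>?\<mu>)" if "integrable ?\<mu> u"
    for u :: "'a \<Rightarrow> real"
    using that by (intro nn_integral_eq_integral[symmetric]) auto
  show ?functional if "isoperimetric_inequality \<Psi> m \<nu>"
    using TV_m_ge_if_isoperimetric[OF that assms(3)] by (auto simp: L1)
  show "isoperimetric_inequality \<Psi> m \<nu>" if ?functional
    unfolding isoperimetric_inequality_def
  proof (intro ballI impI)
    fix A
    assume A: "A \<in> sets ?\<mu>" "0 < emeasure ?\<mu> A \<and> emeasure ?\<mu> A < emeasure ?\<mu> UNIV"
    then have fin: "emeasure ?\<mu> A < \<infinity>"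
      by (auto intro: less_le_trans)
    then have int: "integrable ?\<mu> (indicator A :: 'a \<Rightarrow> real)"
      using A by simp
    moreover have "AE x in ?\<mu>. x \<notin> A \<longrightarrow> indicator A x = (0 :: real)"
      by simp
    ultimately have "ennreal (\<Psi> (measure ?\<mu> A)) * ennreal (\<integral>x. \<bar>indicator A x\<bar> \<partial>?\<mu>) \<le>
        TV_m m \<nu> (indicator A)"
      using that A by blast
    moreover have "ennreal (\<integral>x. \<bar>indicator A x\<bar> \<partial>?\<mu>) = emeasure ?\<mu> A"
      using A fin by (simp add: emeasure_eq_ennreal_measure)
    ultimately show "emeasure ?\<mu> A * ennreal (\<Psi> (measure ?\<mu> A)) \<le> P_m m \<nu> A"
      using A by (simp add: TV_m_indicator mult.commute)
  qed
qed

end
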